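(* Let $T$ be the complete infinite binary tree of depth $\omega$, identified with the set $2^{<\omega}$ of finite binary strings, and make $T$ a graph by connecting each $u\in T$ to $u0$ and $u1$ by an edge. Then $T$ admits no wellordered depth-first traversal.
   Context: A traversal of a connected graph $(V,E)$ is a linear ordering $<$ of $V$ such that the subgraph induced by any initial segment (downward closed subset) of $(V,<)$ is connected. A traversal $<$ of $(V,E)$ is depth-first if for any three vertices $u<v<w$ such that $(u,w)\in E$ and $(u,v)\notin E$, there exists $x$ such that $u<x<v$ and $(x,v)\in E$. A traversal is wellordered if $<$ is a wellordering of $V$. *)

theory Defs
  imports "Graph_Theory.Graph_Theory"
begin

text \<open>
  A graph \<open>(V, E)\<close>, possibly infinite, is a pair digraph whose set of arcs is symmetric;
  an undirected edge is represented by its two arcs.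

  A linear ordering \<open><\<close> of \<open>V\<close> is represented, as usual in HOL, by the corresponding reflexive
  relation \<open>r\<close>; thus \<open>u < v\<close> is \<open>(u, v) \<in> r - Id\<close>.
\<close>

definition initial_segment :: "'a set \<Rightarrow> 'a rel \<Rightarrow> 'a set \<Rightarrow> bool" where
  "initial_segment V r S \<longleftrightarrow> S \<subseteq> V \<and> (\<forall>v\<in>S. \<forall>u\<in>V. (u, v) \<in> r \<longrightarrow> u \<in> S)"

text \<open>
  The library's notion of connectedness excludes the graph without vertices, whereas the empty
  initial segment is not meant to be an obstruction to being a traversal; hence the condition
  \<open>S \<noteq> {}\<close>. If \<open>V\<close> is nonempty, then taking \<open>S = V\<close> shows that a graph with a traversal
  is connected.
\<close>

definition traversal :: "'a pair_pre_digraph \<Rightarrow> 'a rel \<Rightarrow> bool" where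
  "traversal G r \<longleftrightarrow> linear_order_on (pverts G) r \<and>
     (\<forall>S. initial_segment (pverts G) r S \<and> S \<noteq> {} \<longrightarrow>
        Digraph_Component.connected (with_proj G \<restriction> S))"

definition depth_first :: "'a pair_pre_digraph \<Rightarrow> 'a rel \<Rightarrow> bool" where
  "depth_first G r \<longleftrightarrow>
     (\<forall>u\<in>pverts G. \<forall>v\<in>pverts G. \<forall>w\<in>pverts G.
        (u, v) \<in> r - Id \<and> (v, w) \<in> r - Id \<and> (u, w) \<in> parcs G \<and> (u, v) \<notin> parcs G \<longrightarrow>
        (\<exists>x\<in>pverts G. (u, x) \<in> r - Id \<and> (x, v) \<in> r - Id \<and> (x, v) \<in> parcs G))"

definition wellordered :: "'a pair_pre_digraph \<Rightarrow> 'a rel \<Rightarrow> bool" where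
  "wellordered G r \<longleftrightarrow> well_order_on (pverts G) r"

text \<open>
  Finite binary strings are lists of booleans, with \<open>False\<close> for 0 and \<open>True\<close> for 1.
  The strings \<open>u0\<close> and \<open>u1\<close> are obtained by appending a digit at the end.
\<close>

definition binary_tree :: "bool list pair_pre_digraph" where
  "binary_tree = \<lparr> pverts = UNIV,
     parcs = {(u, u @ [b]) | u b. True} \<union> {(u @ [b], u) | u b. True} \<rparr>"

lemma pair_bidirected_digraph_binary_tree: "pair_bidirected_digraph binary_tree"
  by unfold_locales (auto simp: binary_tree_def symmetric_def sym_def)

lemma connected_binary_tree: "Digraph_Component.connected (with_proj binary_tree)"
proof -
  interpret T: pair_bidirected_digraph binary_tree
    by (rule pair_bidirected_digraph_binary_tree)
  have sym: "symmetric (with_proj binary_tree)"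
    by (rule T.pair_sym_arcs)
  have root: "[] \<rightarrow>\<^sup>*\<^bsub>with_proj binary_tree\<^esub> v" for v
  proof (induction v rule: rev_induct)
    case Nil
    show ?case by (rule T.reachable_refl) (simp add: binary_tree_def)
  next
    case (snoc b v)
    have "(v, v @ [b]) \<in> parcs binary_tree"
      by (auto simp: binary_tree_def)
    with snoc show ?case
      using T.reachable_adj_trans by simp
  qed
  have "u \<rightarrow>\<^sup>*\<^bsub>with_proj binary_tree\<^esub> v" for u v
    using T.reachable_trans[OF symmetric_reachable[OF sym root] root] .
  then have "u \<rightarrow>\<^sup>*\<^bsub>mk_symmetric (with_proj binary_tree)\<^esub> v" for u v
    by (rule T.reachable_mk_symmetricI)
  then show ?thesis
    by (auto simp: Digraph_Component.connected_def strongly_connected_def binary_tree_def)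
qed

end

theory Submission
  imports Defs "HOL-Library.Sublist"
begin

text \<open>
  A linear ordering \<open>r\<close> that traverses a tree enters every vertex \<open>v\<close> by at most one edge: the
  vertices before \<open>v\<close> form a connected subgraph, and two neighbours of \<open>v\<close> in it would be joined
  by a path avoiding \<open>v\<close>, whereas removing \<open>v\<close> from a tree separates its neighbours
  (\<open>earlier_neighbour_unique\<close>).

  Let \<open>u < b\<close> be adjacent and let \<open>x\<close> lie strictly between them. Then a depth-first traversal
  visits all neighbours of \<open>x\<close> before \<open>b\<close>: otherwise the depth-first condition for \<open>x\<close>, \<open>b\<close> and
  the late neighbour of \<open>x\<close> gives \<open>b\<close> a neighbour after \<open>x\<close> and before \<open>b\<close>, in addition to \<open>u\<close>
  (\<open>neighbour_before_return\<close>). So before the traversal returns to \<open>u\<close> in order to visit \<open>b\<close>, it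
  has to exhaust everything that is reachable from \<open>x\<close> by moving forward. In the binary tree this
  includes a further branching vertex \<open>y\<close> with later neighbours \<open>d < e < b\<close>, and visiting \<open>e\<close> is
  again a return, namely to \<open>y\<close>. So below every return there is an earlier one, and a wellordering
  cannot contain such a descent.
\<close>

lemma connected_crossing_arc:
  assumes "Digraph_Component.connected H" "p \<in> verts H" "q \<in> verts H" "p \<in> C" "q \<notin> C"
  shows "\<exists>x y. x \<in> C \<and> y \<notin> C \<and> ((x, y) \<in> arcs_ends H \<or> (y, x) \<in> arcs_ends H)"
proof (rule ccontr)
  assume no_crossing: "\<not> ?thesis"
  have "p \<rightarrow>\<^sup>*\<^bsub>mk_symmetric H\<^esub> q"
    using assms by (auto simp: Digraph_Component.connected_def strongly_connected_def)
  then have "(p, q) \<in> rtrancl_on (verts H) (parcs (mk_symmetric H))"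
    by (simp add: reachable_def)
  then have "p \<in> C \<longrightarrow> q \<in> C"
    by (induction rule: rtrancl_on.induct)
      (use no_crossing in \<open>fastforce simp: parcs_mk_symmetric arcs_ends_conv\<close>)+
  with assms show False by simp
qed

lemma pverts_binary_tree: "v \<in> pverts binary_tree"
  by (simp add: binary_tree_def)

abbreviation adjacent :: "bool list \<Rightarrow> bool list \<Rightarrow> bool" where
  "adjacent u v \<equiv> (u, v) \<in> parcs binary_tree"

lemma adjacent_iff: "adjacent u v \<longleftrightarrow> (\<exists>b. v = u @ [b]) \<or> (\<exists>b. u = v @ [b])"
  by (auto simp: binary_tree_def)

lemma adjacent_sym: "adjacent u v \<Longrightarrow> adjacent v u"
  by (auto simp: adjacent_iff)

lemma adjacent_leaves_subtree:
  assumes "adjacent x y" "prefix (v @ [b]) x" "\<not> prefix (v @ [b]) y"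
  shows "y = v"
  using assms by (auto simp: adjacent_iff)

text \<open>
  The strings extending a child of \<open>v\<close> form a subtree that can only be left through \<open>v\<close>, and it
  contains no other neighbour of \<open>v\<close>.
\<close>
lemma neighbours_separated:
  assumes "adjacent p v" "adjacent q v" "p \<noteq> q" "p \<in> S" "q \<in> S" "v \<notin> S"
  shows "\<not> Digraph_Component.connected (with_proj binary_tree \<restriction> S)"
proof -
  have child: False
    if con: "Digraph_Component.connected (with_proj binary_tree \<restriction> S)"
      and c: "v @ [b] \<in> S" and s: "s \<in> S" "adjacent s v" "s \<noteq> v @ [b]" for b s
  proof -
    have "\<not> prefix (v @ [b]) s"
      using s by (auto simp: adjacent_iff prefix_def)
    then obtain x y where "prefix (v @ [b]) x" "\<not> prefix (v @ [b]) y"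
      "(x, y) \<in> arcs_ends (with_proj binary_tree \<restriction> S)
        \<or> (y, x) \<in> arcs_ends (with_proj binary_tree \<restriction> S)"
      using connected_crossing_arc[OF con, of "v @ [b]" s "{x. prefix (v @ [b]) x}"] c s
      by auto
    then have "adjacent x y" "y \<in> S"
      by (auto simp: arcs_ends_def arc_to_ends_def intro: adjacent_sym)
    then show False
      using adjacent_leaves_subtree \<open>prefix (v @ [b]) x\<close> \<open>\<not> prefix (v @ [b]) y\<close> \<open>v \<notin> S\<close>
      by blast
  qed
  \<comment> \<open>As \<open>v\<close> has at most one parent, one of its two neighbours is a child.\<close>
  consider b where "p = v @ [b]" | b where "q = v @ [b]"
    using assms by (auto simp: adjacent_iff)
  then show ?thesis
    using child assms by cases blast+
qed

lemma earlier_neighbour_unique: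
  assumes trav: "traversal binary_tree r"
    and p: "adjacent p v" "(p, v) \<in> r - Id"
    and q: "adjacent q v" "(q, v) \<in> r - Id"
  shows "p = q"
proof (rule ccontr)
  assume "p \<noteq> q"
  let ?S = "{x. (x, v) \<in> r - Id}"
  have "trans r" "antisym r"
    using trav by (auto simp: traversal_def order_on_defs)
  then have "initial_segment (pverts binary_tree) r ?S"
    by (auto simp: initial_segment_def binary_tree_def dest: transD antisymD)
  moreover have "p \<in> ?S" using p by simp
  ultimately have "Digraph_Component.connected (with_proj binary_tree \<restriction> ?S)"
    using trav unfolding traversal_def by blast
  then show False
    using neighbours_separated[OF p(1) q(1) \<open>p \<noteq> q\<close>, of ?S] p q by simp
qed

lemma traversal_binary_tree_linear:
  assumes "traversal binary_tree r"
  shows "trans r" "antisym r" "x \<noteq> y \<Longrightarrow> (x, y) \<in> r - Id \<or> (y, x) \<in> r - Id"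
  using assms by (auto simp: traversal_def order_on_defs total_on_def binary_tree_def)

lemma neighbour_before_return:
  assumes trav: "traversal binary_tree r" and df: "depth_first binary_tree r"
    and ub: "adjacent u b" "(u, x) \<in> r - Id" "(x, b) \<in> r - Id"
    and c: "adjacent x c"
  shows "(c, b) \<in> r - Id"
proof (rule ccontr)
  assume not_before: "(c, b) \<notin> r - Id"
  note lin = traversal_binary_tree_linear[OF trav]
  have ub': "(u, b) \<in> r - Id"
    using ub lin(1,2) by (auto dest: transD antisymD)
  have x_b: "\<not> adjacent x b"
    using earlier_neighbour_unique[OF trav _ ub(3) ub(1) ub'] ub(2) by auto
  then have "(b, c) \<in> r - Id"
    using not_before lin(3)[of b c] c by auto
  then obtain y where y: "(x, y) \<in> r - Id" "(y, b) \<in> r - Id" "adjacent y b"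
    using df ub(3) c x_b pverts_binary_tree unfolding depth_first_def by blast
  then have "y = u"
    using earlier_neighbour_unique[OF trav _ _ ub(1) ub'] by blast
  then show False
    using y(1) ub(2) lin(2) by (auto dest: antisymD)
qed

lemma later_neighbour:
  assumes trav: "traversal binary_tree r" and "adjacent x c" "adjacent x d" "c \<noteq> d"
  shows "(x, c) \<in> r - Id \<or> (x, d) \<in> r - Id"
proof -
  have "c \<noteq> x" "d \<noteq> x" using assms by (auto simp: adjacent_iff)
  then show ?thesis
    using earlier_neighbour_unique[OF trav, of c x d] assms adjacent_sym
      traversal_binary_tree_linear(3)[OF trav] by metis
qed

text \<open>
  A nonempty string has three neighbours, of which at most one comes earlier. The empty string has
  only two, so it need not be a branching point if the traversal starts elsewhere.
\<close>
lemma two_later_neighbours: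
  assumes trav: "traversal binary_tree r" and "y \<noteq> []"
  shows "\<exists>d e. adjacent y d \<and> adjacent y e \<and> (y, d) \<in> r - Id \<and> (d, e) \<in> r - Id"
proof -
  let ?p = "butlast y" and ?l = "y @ [False]" and ?r = "y @ [True]"
  have adj: "adjacent y ?p" "adjacent y ?l" "adjacent y ?r"
    using \<open>y \<noteq> []\<close> by (auto simp: adjacent_iff intro: exI[of _ "last y"])
  have "butlast y \<noteq> y @ [b]" for b
  proof
    assume "butlast y = y @ [b]"
    then have "length (butlast y) = length (y @ [b])" by (rule arg_cong)
    then show False by simp
  qed
  then have ne: "?p \<noteq> ?l" "?p \<noteq> ?r" "?l \<noteq> ?r" by simp_all
  have "\<exists>d e. adjacent y d \<and> adjacent y e \<and> d \<noteq> e \<and> (y, d) \<in> r - Id \<and> (y, e) \<in> r - Id"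
    using later_neighbour[OF trav adj(1,2) ne(1)] later_neighbour[OF trav adj(1,3) ne(2)]
      later_neighbour[OF trav adj(2,3) ne(3)] adj ne by metis
  then show ?thesis
    using traversal_binary_tree_linear(3)[OF trav] by metis
qed

theorem proposition1p5:
  shows "\<not> (\<exists>r. traversal binary_tree r \<and> depth_first binary_tree r \<and> wellordered binary_tree r)"
proof
  assume "\<exists>r. traversal binary_tree r \<and> depth_first binary_tree r \<and> wellordered binary_tree r"
  then obtain r where trav: "traversal binary_tree r" and df: "depth_first binary_tree r"
    and "wf (r - Id)"
    by (auto simp: wellordered_def well_order_on_def)
  \<comment> \<open>These are the returns of the traversal: vertices \<open>b\<close> entered from a vertex \<open>u\<close> that is not
    the one visited immediately before \<open>b\<close>.\<close>
  let ?B = "{b. \<exists>u x. adjacent u b \<and> (u, x) \<in> r - Id \<and> (x, b) \<in> r - Id}"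
  obtain d e where "adjacent [True] e" "([True], d) \<in> r - Id" "(d, e) \<in> r - Id"
    using two_later_neighbours[OF trav, of "[True]"] by blast
  then have "e \<in> ?B" by blast
  then obtain b where "b \<in> ?B" and minimal: "\<And>a. (a, b) \<in> r - Id \<Longrightarrow> a \<notin> ?B"
    by (rule wfE_min[OF \<open>wf (r - Id)\<close>]) blast
  then obtain u x where b: "adjacent u b" and x: "(u, x) \<in> r - Id" "(x, b) \<in> r - Id"
    by blast
  \<comment> \<open>The empty string might have only one later neighbour; that neighbour is then used instead.\<close>
  obtain y where y: "y \<noteq> []" "(u, y) \<in> r - Id" "(y, b) \<in> r - Id"
  proof (cases "x = []")
    case True
    have "adjacent x [False]" "adjacent x [True]"
      using True by (auto simp: adjacent_iff)
    then obtain c where c: "c \<noteq> []" "adjacent x c" "(x, c) \<in> r - Id"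
      using later_neighbour[OF trav, of x "[False]" "[True]"] by blast
    have "(u, c) \<in> r - Id"
      using x(1) c(3) traversal_binary_tree_linear(1,2)[OF trav]
      by (auto dest: transD antisymD)
    with c show ?thesis
      using neighbour_before_return[OF trav df b x] that by blast
  qed (use x that in blast)
  obtain d e where "adjacent y e" "(y, d) \<in> r - Id" "(d, e) \<in> r - Id"
    using two_later_neighbours[OF trav y(1)] by blast
  then have "e \<in> ?B" "(e, b) \<in> r - Id"
    using neighbour_before_return[OF trav df b y(2,3)] by blast+
  then show False using minimal by blast
qed

end
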